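(* Let $0<q<1$. For $\beta\in\mathbb{C}\setminus\{0\}$ with $\beta^2\neq q^{k}$ for all $k\in\mathbb{Z}$, let $L^{\beta}(x)$ and $M^{\beta}(x)$ be the doubly infinite lower triangular matrices (indexed by $m,n\in\mathbb{Z}$, with entries $0$ for $n>m$) given for $n\le m$ by $$L^{\beta}(x)_{m,n} = \frac{C_{m-n}(x;\beta q^n|q)}{(\beta^2 q^{2n};q)_{m-n}}, \qquad M^{\beta}(x)_{m,n} = \frac{\beta^{m-n} q^{(m-1)(m-n)}}{(\beta^2 q^{m+n-1};q)_{m-n}}\, C_{m-n}(x;\beta^{-1}q^{1-m}|q).$$ Then the entrywise limits $L^0(x)_{m,n}=\lim_{\beta\to0}L^{\beta}(x)_{m,n}$ and $M^0(x)_{m,n}=\lim_{\beta\to0}M^{\beta}(x)_{m,n}$ (taken over such $\beta$) exist, and the doubly infinite lower triangular matrices $L^0(x)$ and $M^0(x)$ are given by $$L^{0}(x)_{m,n}=\frac{H_{m-n}(x|q)}{(q;q)_{m-n}},\qquad M^{0}(x)_{m,n}=(-1)^{m-n}q^{\binom{m-n}{2}}\frac{H_{m-n}(x|q^{-1})}{(q;q)_{m-n}},\qquad n\le m,\ m,n\in\mathbb{Z}.$$ Moreover $M^0(x)$ and $L^0(x)$ are each other's inverse, i.e. $L^0(x)M^0(x)=I=M^0(x)L^0(x)$, where $I_{m,n}=\delta_{m,n}$.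
   Context: For $a\in\mathbb{C}$, $p>0$ and $n\in\{0,1,2,\dots\}$, $(a;p)_n=\prod_{j=0}^{n-1}(1-ap^j)$, with $(a;p)_0=1$. For every $\beta\in\mathbb{C}$ and $n\in\{0,1,2,\dots\}$ the continuous $q$-ultraspherical polynomial $C_n(x;\beta|q)$ is the polynomial in $x$ determined by $$C_n(x;\beta|q)=\sum_{k=0}^{n}\frac{(\beta;q)_k(\beta;q)_{n-k}}{(q;q)_k(q;q)_{n-k}}\,e^{i(n-2k)\theta},\qquad x=\cos\theta.$$ The continuous $q$-Hermite polynomials are $$H_n(x|q)=\sum_{k=0}^{n}\frac{(q;q)_n}{(q;q)_k(q;q)_{n-k}}\,e^{i(n-2k)\theta},\qquad x=\cos\theta,$$ and the continuous $q^{-1}$-Hermite polynomials $H_n(x|q^{-1})$ are obtained from this formula by replacing $q$ by $q^{-1}$ everywhere. Each entry of a product of lower triangular matrices indexed by $\mathbb{Z}$ is a finite sum: $(AB)_{m,n}=\sum_{k=n}^{m}A_{m,k}B_{k,n}$ for $n\le m$, and $0$ for $n>m$. *)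

theory Defs
  imports "HOL-Analysis.Analysis" "HOL-Computational_Algebra.Polynomial"
begin

definition qpoch :: "complex \<Rightarrow> real \<Rightarrow> nat \<Rightarrow> complex" where
  "qpoch a p n = (\<Prod>j<n. 1 - a * complex_of_real (p ^ j))"

text \<open>The polynomial in \<open>x\<close> determined by its values \<open>f \<theta>\<close> at \<open>x = cos \<theta>\<close>, \<open>\<theta>\<close> real.
  Existence and uniqueness, for the functions used below, is \<open>ex1_poly_cos\<close>.\<close>
definition poly_in_cos :: "(real \<Rightarrow> complex) \<Rightarrow> complex poly" where
  "poly_in_cos f = (THE p. \<forall>\<theta>. poly p (complex_of_real (cos \<theta>)) = f \<theta>)"

definition q_ultraspherical :: "nat \<Rightarrow> complex \<Rightarrow> real \<Rightarrow> complex poly" where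
  "q_ultraspherical n \<beta> q = poly_in_cos (\<lambda>\<theta>. \<Sum>k\<le>n.
     (qpoch \<beta> q k * qpoch \<beta> q (n - k)) / (qpoch (of_real q) q k * qpoch (of_real q) q (n - k))
     * exp (\<i> * of_int (int n - 2 * int k) * of_real \<theta>))"

text \<open>For \<open>0 < q < 1\<close>, base \<open>p = q\<close> gives the continuous \<open>q\<close>-Hermite polynomials and
  base \<open>p = 1 / q\<close> the continuous \<open>q\<close>-inverse Hermite polynomials.\<close>
definition q_Hermite :: "nat \<Rightarrow> real \<Rightarrow> complex poly" where
  "q_Hermite n p = poly_in_cos (\<lambda>\<theta>. \<Sum>k\<le>n.
     qpoch (of_real p) p n / (qpoch (of_real p) p k * qpoch (of_real p) p (n - k))
     * exp (\<i> * of_int (int n - 2 * int k) * of_real \<theta>))"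

definition admissible :: "real \<Rightarrow> complex set" where
  "admissible q = {\<beta>. \<beta> \<noteq> 0 \<and> (\<forall>k::int. \<beta>\<^sup>2 \<noteq> complex_of_real (q powi k))}"

definition L_mat :: "real \<Rightarrow> complex \<Rightarrow> complex \<Rightarrow> int \<Rightarrow> int \<Rightarrow> complex" where
  "L_mat q \<beta> x m n = (if n \<le> m then
     poly (q_ultraspherical (nat (m - n)) (\<beta> * of_real (q powi n)) q) x
       / qpoch (\<beta>\<^sup>2 * of_real (q powi (2 * n))) q (nat (m - n))
     else 0)"

definition M_mat :: "real \<Rightarrow> complex \<Rightarrow> complex \<Rightarrow> int \<Rightarrow> int \<Rightarrow> complex" where
  "M_mat q \<beta> x m n = (if n \<le> m then
     \<beta> ^ nat (m - n) * of_real (q powi ((m - 1) * (m - n)))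
       / qpoch (\<beta>\<^sup>2 * of_real (q powi (m + n - 1))) q (nat (m - n))
       * poly (q_ultraspherical (nat (m - n)) (inverse \<beta> * of_real (q powi (1 - m))) q) x
     else 0)"

text \<open>\<open>Lim\<close> is unspecified if the limit does not exist, so existence of the limits must be asserted
  separately.\<close>
definition L0_mat :: "real \<Rightarrow> complex \<Rightarrow> int \<Rightarrow> int \<Rightarrow> complex" where
  "L0_mat q x m n = Lim (at 0 within admissible q) (\<lambda>\<beta>. L_mat q \<beta> x m n)"

definition M0_mat :: "real \<Rightarrow> complex \<Rightarrow> int \<Rightarrow> int \<Rightarrow> complex" where
  "M0_mat q x m n = Lim (at 0 within admissible q) (\<lambda>\<beta>. M_mat q \<beta> x m n)"

definition lower_triangular :: "(int \<Rightarrow> int \<Rightarrow> complex) \<Rightarrow> bool" where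
  "lower_triangular A \<longleftrightarrow> (\<forall>m n. m < n \<longrightarrow> A m n = 0)"

text \<open>The matrix product for lower triangular matrices: only the terms \<open>n \<le> k \<le> m\<close> can be nonzero.\<close>
definition lt_mult :: "(int \<Rightarrow> int \<Rightarrow> complex) \<Rightarrow> (int \<Rightarrow> int \<Rightarrow> complex) \<Rightarrow> int \<Rightarrow> int \<Rightarrow> complex" where
  "lt_mult A B m n = (if n \<le> m then \<Sum>k = n..m. A m k * B k n else 0)"

definition id_mat :: "int \<Rightarrow> int \<Rightarrow> complex" where
  "id_mat m n = (if m = n then 1 else 0)"


lemma cos_multiple_poly: "\<exists>p. \<forall>z::complex. poly p (cos z) = cos (of_nat n * z)"
proof (induction n rule: less_induct)
  case (less n)
  consider "n = 0" | "n = 1" | m where "n = Suc (Suc m)"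
    by (metis One_nat_def not0_implies_Suc)
  then show ?case
  proof cases
    case 1 then show ?thesis by (intro exI[of _ 1]) simp
  next
    case 2 then show ?thesis by (intro exI[of _ "[:0, 1:]"]) simp
  next
    case 3
    obtain p where p: "\<forall>z::complex. poly p (cos z) = cos (of_nat m * z)"
      using less 3 by (metis lessI less_SucI)
    obtain r where r: "\<forall>z::complex. poly r (cos z) = cos (of_nat (Suc m) * z)"
      using less 3 by (metis lessI)
    have "poly ([:0, 2:] * r - p) (cos z) = cos (of_nat n * z)" for z
    proof -
      have 1: "of_nat n * z = of_nat (Suc m) * z + z"
        and 2: "of_nat m * z = of_nat (Suc m) * z - z" using 3 by (simp_all add: algebra_simps)
      have "cos (of_nat n * z) = 2 * cos z * cos (of_nat (Suc m) * z) - cos (of_nat m * z)"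
        unfolding 1 2 cos_add cos_diff by (simp add: algebra_simps)
      then show ?thesis using p r by simp
    qed
    then show ?thesis by blast
  qed
qed

text \<open>Palindromic trigonometric sums are polynomials in \<open>cos\<close>, also for complex arguments.\<close>
lemma ex_poly_cos:
  fixes c :: "nat \<Rightarrow> complex"
  assumes sym: "\<And>k. k \<le> n \<Longrightarrow> c (n - k) = c k"
  shows "\<exists>p. \<forall>z::complex. poly p (cos z) = (\<Sum>k\<le>n. c k * exp (\<i> * of_int (int n - 2 * int k) * z))"
proof -
  obtain T where T: "\<And>j z. poly (T j) (cos z) = cos (of_nat j * z :: complex)"
    using cos_multiple_poly by metis
  have cosT: "poly (T (nat \<bar>i\<bar>)) (cos z) = cos (of_int i * z)" for i :: int and z :: complex
    using T[of "nat \<bar>i\<bar>" z] by (cases "i \<ge> 0") auto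
  define p where "p = (\<Sum>k\<le>n. smult (c k) (T (nat \<bar>int n - 2 * int k\<bar>)))"
  have "poly p (cos z) = (\<Sum>k\<le>n. c k * exp (\<i> * of_int (int n - 2 * int k) * z))" (is "_ = ?S") for z
  proof -
    have "?S = (\<Sum>k\<le>n. c (n - k) * exp (\<i> * of_int (int n - 2 * int (n - k)) * z))"
      by (rule sum.nat_diff_reindex[symmetric, of _ "Suc n", simplified lessThan_Suc_atMost, simplified])
    also have "\<dots> = (\<Sum>k\<le>n. c k * exp (- (\<i> * of_int (int n - 2 * int k) * z)))"
      by (intro sum.cong refl) (auto simp: sym of_nat_diff algebra_simps)
    finally have rev: "?S = (\<Sum>k\<le>n. c k * exp (- (\<i> * of_int (int n - 2 * int k) * z)))" (is "_ = ?R") .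
    have "2 * ?S = ?S + ?R" using rev by simp
    also have "\<dots> = (\<Sum>k\<le>n. c k * (2 * cos (of_int (int n - 2 * int k) * z)))"
      unfolding sum.distrib[symmetric] cos_exp_eq
      by (intro sum.cong refl) (simp add: field_simps del: of_int_diff)
    also have "\<dots> = 2 * poly p (cos z)"
      unfolding p_def poly_sum poly_smult cosT by (simp add: sum_distrib_left mult.left_commute)
    finally show ?thesis by simp
  qed
  then show ?thesis by blast
qed

lemma poly_cos_unique:
  assumes "\<forall>\<theta>. poly p (complex_of_real (cos \<theta>)) = poly r (complex_of_real (cos \<theta>))"
  shows "p = r"
proof (rule ccontr)
  assume "p \<noteq> r"
  then have "finite {z. poly (p - r) z = 0}" by (intro poly_roots_finite) simp
  moreover have "complex_of_real ` {-1..1} \<subseteq> {z. poly (p - r) z = 0}"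
  proof clarify
    fix t :: real assume "t \<in> {-1..1}"
    then have "cos (arccos t) = t" by simp
    then show "poly (p - r) (complex_of_real t) = 0" using assms by (metis poly_diff right_minus_eq)
  qed
  ultimately have "finite (complex_of_real ` {-1..1})" by (rule rev_finite_subset)
  then have "finite {-1..1::real}" by (rule finite_imageD) (simp add: inj_on_def)
  then show False by (simp add: infinite_Icc)
qed

lemma ex1_poly_cos:
  fixes c :: "nat \<Rightarrow> complex"
  assumes "\<And>k. k \<le> n \<Longrightarrow> c (n - k) = c k"
  shows "\<exists>!p. \<forall>\<theta>. poly p (complex_of_real (cos \<theta>))
           = (\<Sum>k\<le>n. c k * exp (\<i> * of_int (int n - 2 * int k) * of_real \<theta>))"
proof -
  obtain p where "\<forall>z::complex. poly p (cos z) = (\<Sum>k\<le>n. c k * exp (\<i> * of_int (int n - 2 * int k) * z))"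
    using ex_poly_cos[of n c] assms by blast
  then have "\<forall>\<theta>. poly p (complex_of_real (cos \<theta>))
           = (\<Sum>k\<le>n. c k * exp (\<i> * of_int (int n - 2 * int k) * of_real \<theta>))"
    by (metis cos_of_real)
  then show ?thesis by (intro ex1I[of _ p]) (auto intro: poly_cos_unique)
qed

lemma poly_q_ultraspherical:
  "poly (q_ultraspherical n \<beta> q) (complex_of_real (cos \<theta>)) = (\<Sum>k\<le>n.
     (qpoch \<beta> q k * qpoch \<beta> q (n - k)) / (qpoch (of_real q) q k * qpoch (of_real q) q (n - k))
     * exp (\<i> * of_int (int n - 2 * int k) * of_real \<theta>))"
  unfolding q_ultraspherical_def poly_in_cos_def
  by (rule spec[OF theI'[OF ex1_poly_cos]]) (simp add: mult.commute)

lemma poly_q_Hermite: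
  "poly (q_Hermite n p) (complex_of_real (cos \<theta>)) = (\<Sum>k\<le>n.
     qpoch (of_real p) p n / (qpoch (of_real p) p k * qpoch (of_real p) p (n - k))
     * exp (\<i> * of_int (int n - 2 * int k) * of_real \<theta>))"
  unfolding q_Hermite_def poly_in_cos_def
  by (rule spec[OF theI'[OF ex1_poly_cos]]) (simp add: mult.commute)

end

theory Submission
  imports Defs "HOL-Computational_Algebra.Formal_Power_Series"
begin

text \<open>
  Write \<open>x = cos z\<close> with \<open>z\<close> complex and put \<open>w = exp (\<i> z)\<close>. The defining sums of both families of
  polynomials persist for complex \<open>z\<close>, because palindromic trigonometric sums are polynomials in
  \<open>cos z\<close> and a polynomial is determined by its values on \<open>[-1, 1]\<close>.

  The limits are then limits of finite sums. For \<open>L\<close> one lets the parameter of every \<open>q\<close>-shifted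
  factorial tend to \<open>0\<close>. For \<open>M\<close> the parameter tends to infinity, but with \<open>t = \<beta> q\<^bsup>m-1\<^esup>\<close> the prefactor
  is \<open>t\<^bsup>m-n\<^esup>\<close>, which is exactly what turns the two factors \<open>(1/t; q)\<^sub>k\<close> and \<open>(1/t; q)\<^bsub>m-n-k\<^esub>\<close> into
  polynomials in \<open>t\<close>; their values at \<open>t = 0\<close> are signed powers of \<open>q\<close>, and inversion of the base
  turns the resulting sum into a \<open>q\<^sup>-\<^sup>1\<close>-Hermite polynomial.

  Both limit matrices depend on \<open>m - n\<close> only, so they multiply like formal power series.
  The series of \<open>L\<^sup>0\<close> is \<open>e(w s) e(s/w)\<close> and that of \<open>M\<^sup>0\<close> is \<open>E(w s) E(s/w)\<close>, where \<open>e\<close> and \<open>E\<close>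
  are Euler's two \<open>q\<close>-exponential series \<open>1/(s; q)\<^sub>\<infinity>\<close> and \<open>(s; q)\<^sub>\<infinity>\<close>. As \<open>e E = 1\<close>
  (\<open>q_exp_mult\<close>), the matrices are inverse to each other.
\<close>

section \<open>The defining sums at complex arguments\<close>

text \<open>The right-hand side is itself a polynomial in \<open>cos z\<close> by the symmetry of the coefficients, and the
  two polynomials agree on the interval \<open>[-1, 1]\<close>. Complex \<open>z\<close> are needed since only then does \<open>cos z\<close> take
  every complex value.\<close>

lemma poly_eq_trig_sum_complex:
  fixes c :: "nat \<Rightarrow> complex"
  assumes sym: "\<And>k. k \<le> n \<Longrightarrow> c (n - k) = c k"
    and real: "\<And>\<theta>. poly p (complex_of_real (cos \<theta>))
           = (\<Sum>k\<le>n. c k * exp (\<i> * of_int (int n - 2 * int k) * of_real \<theta>))"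
  shows "poly p (cos z) = (\<Sum>k\<le>n. c k * (exp (\<i> * z) ^ (n - k) * inverse (exp (\<i> * z)) ^ k))"
proof -
  obtain r where r: "\<And>z::complex. poly r (cos z) = (\<Sum>k\<le>n. c k * exp (\<i> * of_int (int n - 2 * int k) * z))"
    using ex_poly_cos[of n c] sym by blast
  have "p = r"
    by (rule poly_cos_unique) (use r real in \<open>simp flip: cos_of_real\<close>)
  moreover have "exp (\<i> * of_int (int n - 2 * int k) * z) = exp (\<i> * z) ^ (n - k) * inverse (exp (\<i> * z)) ^ k"
    if "k \<le> n" for k
  proof -
    have "exp (\<i> * z) ^ (n - k) * inverse (exp (\<i> * z)) ^ k
        = exp (of_nat (n - k) * (\<i> * z) + of_nat k * (- (\<i> * z)))"
      by (simp only: exp_of_nat_mult exp_add exp_minus)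
    also have "of_nat (n - k) * (\<i> * z) + of_nat k * (- (\<i> * z)) = \<i> * of_int (int n - 2 * int k) * z"
      using that by (simp add: of_nat_diff algebra_simps)
    finally show ?thesis by simp
  qed
  ultimately show ?thesis
    using r[of z] by simp
qed

lemma poly_q_ultraspherical_complex:
  "poly (q_ultraspherical n \<beta> q) (cos z) = (\<Sum>k\<le>n.
     (qpoch \<beta> q k * qpoch \<beta> q (n - k)) / (qpoch (of_real q) q k * qpoch (of_real q) q (n - k))
     * (exp (\<i> * z) ^ (n - k) * inverse (exp (\<i> * z)) ^ k))"
  by (rule poly_eq_trig_sum_complex[OF _ poly_q_ultraspherical]) (simp add: mult.commute)

lemma poly_q_Hermite_complex:
  "poly (q_Hermite n p) (cos z) = (\<Sum>k\<le>n.
     qpoch (of_real p) p n / (qpoch (of_real p) p k * qpoch (of_real p) p (n - k))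
     * (exp (\<i> * z) ^ (n - k) * inverse (exp (\<i> * z)) ^ k))"
  by (rule poly_eq_trig_sum_complex[OF _ poly_q_Hermite]) (simp add: mult.commute)

section \<open>Shifted factorials\<close>

lemma qpoch_self_Suc: "qpoch (of_real q) q (Suc n) = qpoch (of_real q) q n * (1 - of_real q ^ Suc n)"
  by (simp add: qpoch_def)

lemma of_real_power_neq_1:
  assumes "0 < q" "q < 1" "n > 0"
  shows "complex_of_real q ^ n \<noteq> 1"
  using assms power_less_one_iff[of q n]
  by (metis less_irrefl less_imp_le of_real_1 of_real_eq_iff of_real_power)

lemma qpoch_self_nonzero:
  assumes "0 < q" "q < 1"
  shows "qpoch (of_real q) q n \<noteq> 0"
  by (induction n)
    (use of_real_power_neq_1[OF assms] in \<open>auto simp: qpoch_self_Suc simp del: power_Suc\<close>, simp add: qpoch_def)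

lemma power_mult_qpoch_inverse:
  assumes "t \<noteq> 0"
  shows "t ^ k * qpoch (inverse t) q k = (\<Prod>j<k. t - of_real q ^ j)"
proof -
  have "t ^ k * qpoch (inverse t) q k = (\<Prod>j<k. t * (1 - inverse t * of_real q ^ j))"
    by (simp add: qpoch_def prod.distrib)
  then show ?thesis
    using assms by (simp add: right_diff_distrib flip: mult.assoc)
qed

lemma prod_minus_powers: "(\<Prod>j<k. - (a ^ j)) = (- 1) ^ k * (a :: complex) ^ (k choose 2)"
  by (induction k) (simp_all add: numeral_2_eq_2 power_add)

lemma choose_2_split: "(a + b) choose 2 = (a choose 2) + (b choose 2) + a * b"
  by (induction a) (simp_all add: numeral_2_eq_2)

text \<open>Factor by factor this is \<open>(1 - q\<^sup>-\<^sup>j) q\<^sup>j = - (1 - q\<^sup>j)\<close> for \<open>j = 1, \<dots>, n\<close>.\<close>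

lemma qpoch_inverse_base:
  assumes "q \<noteq> 0"
  shows "qpoch (of_real (1 / q)) (1 / q) n * of_real q ^ (Suc n choose 2)
           = (- 1) ^ n * qpoch (of_real q) q n"
proof (induction n)
  case (Suc n)
  have choose: "Suc (Suc n) choose 2 = (Suc n choose 2) + Suc n"
    by (simp add: numeral_2_eq_2)
  have last: "(1 - of_real (1 / q) ^ Suc n) * complex_of_real q ^ Suc n = - (1 - of_real q ^ Suc n)"
    using assms by (simp add: field_simps)
  have "qpoch (of_real (1 / q)) (1 / q) (Suc n) * of_real q ^ (Suc (Suc n) choose 2)
     = (qpoch (of_real (1 / q)) (1 / q) n * of_real q ^ (Suc n choose 2))
       * ((1 - of_real (1 / q) ^ Suc n) * of_real q ^ Suc n)"
    unfolding qpoch_self_Suc choose power_add by (simp only: mult_ac)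
  then show ?case
    unfolding Suc.IH last by (simp add: qpoch_self_Suc del: minus_diff_eq)
qed (simp add: qpoch_def numeral_2_eq_2)

section \<open>Euler's two exponential series\<close>

text \<open>The expansion of \<open>1/(s; q)\<^sub>\<infinity>\<close>.\<close>

definition q_exp :: "real \<Rightarrow> complex fps" where
  "q_exp q = Abs_fps (\<lambda>n. 1 / qpoch (of_real q) q n)"

text \<open>The expansion of \<open>(s; q)\<^sub>\<infinity>\<close>.\<close>

definition q_Exp :: "real \<Rightarrow> complex fps" where
  "q_Exp q = Abs_fps (\<lambda>n. (- 1) ^ n * of_real q ^ (n choose 2) / qpoch (of_real q) q n)"

definition fps_dilate :: "'a \<Rightarrow> 'a::comm_ring_1 fps \<Rightarrow> 'a fps" where
  "fps_dilate c f = Abs_fps (\<lambda>n. c ^ n * fps_nth f n)"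

lemma fps_dilate_mult: "fps_dilate c (f * g) = fps_dilate c f * fps_dilate c g"
proof (rule fps_ext)
  fix n
  have "c ^ n * (fps_nth f i * fps_nth g (n - i)) = c ^ i * fps_nth f i * (c ^ (n - i) * fps_nth g (n - i))"
    if "i \<le> n" for i
    using power_add[of c i "n - i"] that by (simp add: algebra_simps)
  then show "fps_nth (fps_dilate c (f * g)) n = fps_nth (fps_dilate c f * fps_dilate c g) n"
    by (simp add: fps_dilate_def fps_mult_nth sum_distrib_left)
qed

lemma fps_dilate_1: "fps_dilate c 1 = 1"
  by (rule fps_ext) (simp add: fps_dilate_def)

text \<open>The functional equation of \<open>1/(s; q)\<^sub>\<infinity>\<close>: dilation by \<open>q\<close> removes the first factor \<open>1 - s\<close>.\<close>

lemma fps_dilate_q_exp: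
  assumes "0 < q" "q < 1"
  shows "fps_dilate (of_real q) (q_exp q) = (1 - fps_X) * q_exp q"
proof (rule fps_ext)
  fix n
  show "fps_nth (fps_dilate (of_real q) (q_exp q)) n = fps_nth ((1 - fps_X) * q_exp q) n"
  proof (cases n)
    case (Suc k)
    have "1 - complex_of_real q ^ Suc k \<noteq> 0" "qpoch (of_real q) q k \<noteq> 0"
      using of_real_power_neq_1[OF assms, of "Suc k"] qpoch_self_nonzero[OF assms] by auto
    then show ?thesis
      unfolding Suc
      by (simp add: fps_dilate_def q_exp_def qpoch_self_Suc left_diff_distrib divide_simps del: power_Suc)
        (simp add: algebra_simps)
  qed (simp add: fps_dilate_def q_exp_def)
qed

text \<open>The same for \<open>(s; q)\<^sub>\<infinity>\<close>; coefficientwise it rests on \<open>(k+1 choose 2) = (k choose 2) + k\<close>.\<close>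

lemma q_Exp_eq_dilate:
  assumes "0 < q" "q < 1"
  shows "q_Exp q = (1 - fps_X) * fps_dilate (of_real q) (q_Exp q)"
proof (rule fps_ext)
  fix n
  show "fps_nth (q_Exp q) n = fps_nth ((1 - fps_X) * fps_dilate (of_real q) (q_Exp q)) n"
  proof (cases n)
    case (Suc k)
    have "1 - complex_of_real q ^ Suc k \<noteq> 0" "qpoch (of_real q) q k \<noteq> 0"
      using of_real_power_neq_1[OF assms, of "Suc k"] qpoch_self_nonzero[OF assms] by auto
    moreover have "Suc k choose 2 = (k choose 2) + k"
      by (simp add: numeral_2_eq_2)
    ultimately show ?thesis
      unfolding Suc
      by (simp add: fps_dilate_def q_Exp_def qpoch_self_Suc left_diff_distrib divide_simps power_add
          del: power_Suc)
        (simp add: algebra_simps)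
  qed (simp add: fps_dilate_def q_Exp_def)
qed

text \<open>By the two functional equations the product is invariant under dilation by \<open>q\<close>. Since
  \<open>q\<^sup>n \<noteq> 1\<close> for \<open>n > 0\<close>, only constant series are.\<close>

lemma q_exp_mult:
  assumes "0 < q" "q < 1"
  shows "q_exp q * q_Exp q = 1"
proof -
  let ?G = "q_exp q * q_Exp q"
  have "fps_dilate (of_real q) ?G = (1 - fps_X) * q_exp q * fps_dilate (of_real q) (q_Exp q)"
    by (simp only: fps_dilate_mult fps_dilate_q_exp[OF assms])
  also have "\<dots> = q_exp q * ((1 - fps_X) * fps_dilate (of_real q) (q_Exp q))"
    by (simp only: mult_ac)
  also have "\<dots> = ?G"
    by (simp only: q_Exp_eq_dilate[OF assms, symmetric])
  finally have inv: "fps_dilate (of_real q) ?G = ?G" .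
  show ?thesis
  proof (rule fps_ext)
    fix n
    have "of_real q ^ n * fps_nth ?G n = fps_nth ?G n"
      using arg_cong[OF inv, of "\<lambda>f. fps_nth f n"] by (simp add: fps_dilate_def)
    then show "fps_nth ?G n = fps_nth 1 n"
      using of_real_power_neq_1[OF assms, of n]
      by (cases n) (auto simp: q_exp_def q_Exp_def qpoch_def numeral_2_eq_2 simp del: power_Suc)
  qed
qed

section \<open>Hermite polynomials as coefficients of products of exponential series\<close>

definition q_Hermite_fps :: "real \<Rightarrow> complex \<Rightarrow> complex fps" where
  "q_Hermite_fps q w = fps_dilate (inverse w) (q_exp q) * fps_dilate w (q_exp q)"

definition q_inv_Hermite_fps :: "real \<Rightarrow> complex \<Rightarrow> complex fps" where
  "q_inv_Hermite_fps q w = fps_dilate (inverse w) (q_Exp q) * fps_dilate w (q_Exp q)"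

lemma q_Hermite_fps_mult:
  assumes "0 < q" "q < 1"
  shows "q_Hermite_fps q w * q_inv_Hermite_fps q w = 1"
proof -
  have "q_Hermite_fps q w * q_inv_Hermite_fps q w
      = fps_dilate (inverse w) (q_exp q * q_Exp q) * fps_dilate w (q_exp q * q_Exp q)"
    unfolding q_Hermite_fps_def q_inv_Hermite_fps_def fps_dilate_mult by (simp only: mult_ac)
  then show ?thesis
    by (simp add: q_exp_mult[OF assms] fps_dilate_1)
qed

lemma q_Hermite_fps_nth:
  "fps_nth (q_Hermite_fps q w) n = (\<Sum>k\<le>n.
     1 / (qpoch (of_real q) q k * qpoch (of_real q) q (n - k)) * (w ^ (n - k) * inverse w ^ k))"
  unfolding q_Hermite_fps_def fps_mult_nth atLeast0AtMost
  by (intro sum.cong refl) (simp add: fps_dilate_def q_exp_def)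

text \<open>The signed powers of \<open>q\<close> are kept as products, the form in which they arise as values at \<open>t = 0\<close> of
  the polynomials \<open>t\<^sup>k (1/t; q)\<^sub>k\<close> in the limit of \<open>M\<close>.\<close>

lemma q_inv_Hermite_fps_nth:
  "fps_nth (q_inv_Hermite_fps q w) n = (\<Sum>k\<le>n.
     ((\<Prod>j<k. - (of_real q ^ j)) * (\<Prod>j<n - k. - (of_real q ^ j)))
       / (qpoch (of_real q) q k * qpoch (of_real q) q (n - k)) * (w ^ (n - k) * inverse w ^ k))"
  unfolding q_inv_Hermite_fps_def fps_mult_nth atLeast0AtMost
  by (intro sum.cong refl) (simp add: fps_dilate_def q_Exp_def prod_minus_powers)

lemma q_Hermite_fps_nth_eq_poly:
  assumes "0 < q" "q < 1"
  shows "fps_nth (q_Hermite_fps q (exp (\<i> * z))) n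
           = poly (q_Hermite n q) (cos z) / qpoch (of_real q) q n"
  using qpoch_self_nonzero[OF assms, of n]
  by (simp add: q_Hermite_fps_nth poly_q_Hermite_complex sum_divide_distrib)

text \<open>Inverting the base in the \<open>q\<close>-binomial coefficient produces the factor \<open>q\<^bsup>-k(n-k)\<^esup>\<close>, and
  \<open>(n choose 2) - k (n - k) = (k choose 2) + (n - k choose 2)\<close> is the exponent on the left.\<close>

lemma q_inv_Hermite_fps_nth_eq_poly:
  assumes "0 < q" "q < 1"
  shows "fps_nth (q_inv_Hermite_fps q (exp (\<i> * z))) n
           = (- 1) ^ n * of_real (q ^ (n choose 2))
             * poly (q_Hermite n (1 / q)) (cos z) / qpoch (of_real q) q n"
proof -
  define Q P where "Q = complex_of_real q" and "P = (\<lambda>n. qpoch (of_real q) q n)"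
  define R where "R = (\<lambda>n. qpoch (of_real (1 / q)) (1 / q) n)"
  have Q: "Q \<noteq> 0" and P: "P n \<noteq> 0" for n
    using assms qpoch_self_nonzero[OF assms] by (auto simp: Q_def P_def)
  have fold: "qpoch Q q n = P n" "qpoch (of_real (1 / q)) (1 / q) n = R n" "of_real q = Q" for n
    by (simp_all only: P_def R_def Q_def)
  have R: "R n = (- 1) ^ n * P n / Q ^ (Suc n choose 2)" for n
  proof -
    have "R n * Q ^ (Suc n choose 2) = (- 1) ^ n * P n"
      using qpoch_inverse_base[of q n] assms(1) unfolding fold by simp
    then show ?thesis
      using Q by (simp add: eq_divide_eq)
  qed
  have coeff: "(- 1) ^ k * Q ^ (k choose 2) * ((- 1) ^ (n - k) * Q ^ ((n - k) choose 2)) / (P k * P (n - k))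
      = (- 1) ^ n * Q ^ (n choose 2) * (R n / (R k * R (n - k))) / P n" if "k \<le> n" for k
  proof -
    obtain l where n: "n = k + l"
      using le_Suc_ex[OF \<open>k \<le> n\<close>] by blast
    have Suc: "Suc j choose 2 = (j choose 2) + j" for j
      by (simp add: numeral_2_eq_2)
    \<comment> \<open>\<open>A\<close>, \<open>B\<close>, \<open>C\<close>, \<open>D\<close>, \<open>E\<close> abstract the powers of \<open>Q\<close> with exponents \<open>k choose 2\<close>, \<open>l choose 2\<close>,
       \<open>k l\<close>, \<open>k\<close>, \<open>l\<close>, whose product has exponent \<open>n + 1 choose 2\<close>; \<open>s\<close>, \<open>r\<close> are the signs.\<close>
    have "s * A * (r * B) / (p * p') = s * r * (A * B * C) *
        (s * r * p'' / (A * B * C * (D * E)) / (s * p / (A * D) * (r * p' / (B * E)))) / p''"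
      if "s \<noteq> 0" "r \<noteq> 0" "A \<noteq> 0" "B \<noteq> 0" "C \<noteq> 0" "D \<noteq> 0" "E \<noteq> 0" "p \<noteq> 0" "p' \<noteq> 0" "p'' \<noteq> 0"
      for s r A B C D E p p' p'' :: complex
    proof -
      have "s * p / (A * D) * (r * p' / (B * E)) = s * r * (p * p') / (A * B * (D * E))"
        by (simp add: mult_ac)
      moreover have "s * r * p'' / (A * B * C * (D * E)) / (s * r * (p * p') / (A * B * (D * E)))
          = p'' / (C * (p * p'))"
        using that by simp
      ultimately show ?thesis
        using that by simp
    qed
    from this[of "(- 1) ^ k" "(- 1) ^ l" "Q ^ (k choose 2)" "Q ^ (l choose 2)" "Q ^ (k * l)"
        "Q ^ k" "Q ^ l" "P k" "P l" "P n"]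
    show ?thesis
      using Q P unfolding R n Suc choose_2_split power_add by simp
  qed
  have "fps_nth (q_inv_Hermite_fps q (exp (\<i> * z))) n
     = (\<Sum>k\<le>n. (- 1) ^ n * Q ^ (n choose 2) * (R n / (R k * R (n - k))) / P n
          * (exp (\<i> * z) ^ (n - k) * inverse (exp (\<i> * z)) ^ k))"
    unfolding q_inv_Hermite_fps_nth fold prod_minus_powers
    by (intro sum.cong refl arg_cong2[of _ _ _ _ "(*)"] coeff) simp
  then show ?thesis
    unfolding poly_q_Hermite_complex of_real_power fold
    by (simp add: sum_distrib_left sum_divide_distrib mult.assoc)
qed

section \<open>The limits\<close>

text \<open>On the imaginary axis \<open>\<beta>\<^sup>2 < 0\<close>, so \<open>0\<close> is a limit point of the admissible parameters and
  limits along them are unique.\<close>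

lemma at_0_within_admissible_neq_bot:
  assumes "0 < q"
  shows "at 0 within admissible q \<noteq> bot"
proof -
  have "\<i> * of_real r \<in> admissible q" if "r > 0" for r
  proof -
    have "(\<i> * of_real r)\<^sup>2 \<noteq> complex_of_real (q powi k)" for k
    proof
      assume "(\<i> * of_real r)\<^sup>2 = complex_of_real (q powi k)"
      then have "complex_of_real (- (r\<^sup>2)) = complex_of_real (q powi k)"
        by (simp add: power_mult_distrib)
      then have "- (r\<^sup>2) = q powi k"
        by (simp only: of_real_eq_iff)
      moreover have "q powi k > 0" "r\<^sup>2 > 0"
        using assms that by auto
      ultimately show False
        by linarith
    qed
    then show ?thesis
      using that by (simp add: admissible_def)
  qed
  then have "\<exists>\<beta>\<in>admissible q. \<beta> \<noteq> 0 \<and> dist \<beta> 0 < e" if "e > 0" for e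
    by (rule bexI[of _ "\<i> * of_real (e / 2)", rotated]) (use that in \<open>auto simp: norm_mult\<close>)
  then have "0 islimpt admissible q"
    by (simp add: islimpt_approachable)
  then show ?thesis
    by (simp add: trivial_limit_within)
qed

lemma tendsto_qpoch:
  assumes "(f \<longlongrightarrow> 0) F"
  shows "((\<lambda>\<beta>. qpoch (f \<beta>) q k) \<longlongrightarrow> 1) F"
proof -
  have "((\<lambda>\<beta>. qpoch (f \<beta>) q k) \<longlongrightarrow> (\<Prod>j<k. 1 - 0 * complex_of_real (q ^ j))) F"
    unfolding qpoch_def by (intro tendsto_intros assms)
  then show ?thesis by simp
qed

lemma tendsto_0_mult_const: "((\<lambda>\<beta>::complex. \<beta> * c) \<longlongrightarrow> 0) (at 0 within S)"
  by (auto intro!: tendsto_eq_intros)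

lemma tendsto_0_square_mult_const: "((\<lambda>\<beta>::complex. \<beta>\<^sup>2 * c) \<longlongrightarrow> 0) (at 0 within S)"
  by (auto intro!: tendsto_eq_intros)

lemma L_mat_tendsto:
  assumes "n \<le> m"
  shows "((\<lambda>\<beta>. L_mat q \<beta> (cos z) m n) \<longlongrightarrow> fps_nth (q_Hermite_fps q (exp (\<i> * z))) (nat (m - n)))
           (at 0 within S)"
proof -
  let ?N = "nat (m - n)"
  have "((\<lambda>\<beta>. L_mat q \<beta> (cos z) m n) \<longlongrightarrow>
      (\<Sum>k\<le>?N. (1 * 1) * inverse (qpoch (of_real q) q k * qpoch (of_real q) q (?N - k))
        * (exp (\<i> * z) ^ (?N - k) * inverse (exp (\<i> * z)) ^ k)) / 1) (at 0 within S)"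
    unfolding L_mat_def poly_q_ultraspherical_complex if_P[OF assms] divide_inverse[of "qpoch _ _ _ * _"]
    by (intro tendsto_intros tendsto_qpoch tendsto_0_mult_const tendsto_0_square_mult_const) simp
  then show ?thesis
    by (simp add: q_Hermite_fps_nth divide_inverse)
qed

text \<open>The prefactor \<open>t\<^bsup>m-n\<^esup>\<close>, with \<open>t = \<beta> q\<^bsup>m-1\<^esup>\<close>, absorbs the poles of the shifted factorials at
  \<open>t = 0\<close>.\<close>

lemma M_mat_eq:
  fixes q :: real and \<beta> :: complex and m :: int
  defines "t \<equiv> \<beta> * of_real (q powi (m - 1))"
  assumes "q \<noteq> 0" "\<beta> \<noteq> 0" "n \<le> m"
  shows "M_mat q \<beta> (cos z) m n = (\<Sum>k\<le>nat (m - n).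
      ((\<Prod>j<k. t - of_real q ^ j) * (\<Prod>j<nat (m - n) - k. t - of_real q ^ j))
        * inverse (qpoch (of_real q) q k * qpoch (of_real q) q (nat (m - n) - k))
      * (exp (\<i> * z) ^ (nat (m - n) - k) * inverse (exp (\<i> * z)) ^ k))
      / qpoch (\<beta>\<^sup>2 * of_real (q powi (m + n - 1))) q (nat (m - n))"
proof -
  define N where "N = nat (m - n)"
  have N: "m - n = int N"
    using assms by (simp add: N_def)
  have t: "t \<noteq> 0"
    using assms by (simp add: t_def)
  have pre: "\<beta> ^ N * of_real (q powi ((m - 1) * (m - n))) = t ^ N"
    unfolding N power_int_mult t_def by (simp add: power_mult_distrib)
  have "q powi (1 - m) = inverse (q powi (m - 1))"
    by (metis minus_diff_eq power_int_minus)
  then have par: "inverse \<beta> * of_real (q powi (1 - m)) = inverse t"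
    by (simp add: t_def)
  have summand: "t ^ N * (qpoch (inverse t) q k * qpoch (inverse t) q (N - k))
      = (\<Prod>j<k. t - of_real q ^ j) * (\<Prod>j<N - k. t - of_real q ^ j)" if "k \<le> N" for k
    unfolding power_mult_qpoch_inverse[OF t, symmetric]
    using power_add[of t k "N - k"] that by (simp add: mult_ac)
  have "t ^ N * poly (q_ultraspherical N (inverse t) q) (cos z)
      = (\<Sum>k\<le>N. ((\<Prod>j<k. t - of_real q ^ j) * (\<Prod>j<N - k. t - of_real q ^ j))
          * inverse (qpoch (of_real q) q k * qpoch (of_real q) q (N - k))
        * (exp (\<i> * z) ^ (N - k) * inverse (exp (\<i> * z)) ^ k))"
    unfolding poly_q_ultraspherical_complex sum_distrib_left
    by (intro sum.cong refl) (simp add: divide_inverse flip: summand mult.assoc)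
  then show ?thesis
    using assms pre par unfolding M_mat_def N_def[symmetric] by simp
qed

lemma M_mat_tendsto:
  assumes "q \<noteq> 0" "n \<le> m"
  shows "((\<lambda>\<beta>. M_mat q \<beta> (cos z) m n) \<longlongrightarrow> fps_nth (q_inv_Hermite_fps q (exp (\<i> * z))) (nat (m - n)))
           (at 0 within S)"
proof -
  let ?N = "nat (m - n)" and ?t = "\<lambda>\<beta>. \<beta> * complex_of_real (q powi (m - 1))"
  have "((\<lambda>\<beta>. (\<Sum>k\<le>?N.
      ((\<Prod>j<k. ?t \<beta> - of_real q ^ j) * (\<Prod>j<?N - k. ?t \<beta> - of_real q ^ j))
        * inverse (qpoch (of_real q) q k * qpoch (of_real q) q (?N - k))
      * (exp (\<i> * z) ^ (?N - k) * inverse (exp (\<i> * z)) ^ k))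
      / qpoch (\<beta>\<^sup>2 * of_real (q powi (m + n - 1))) q ?N) \<longlongrightarrow>
     (\<Sum>k\<le>?N. ((\<Prod>j<k. 0 - of_real q ^ j) * (\<Prod>j<?N - k. 0 - of_real q ^ j))
        * inverse (qpoch (of_real q) q k * qpoch (of_real q) q (?N - k))
      * (exp (\<i> * z) ^ (?N - k) * inverse (exp (\<i> * z)) ^ k)) / 1) (at 0 within S)"
    by (intro tendsto_divide tendsto_sum tendsto_mult tendsto_prod tendsto_diff tendsto_const
        tendsto_qpoch tendsto_0_mult_const tendsto_0_square_mult_const) simp
  \<comment> \<open>the sum agrees with \<open>M\<close> for \<open>\<beta> \<noteq> 0\<close>, which is all that the limit at \<open>0\<close> sees\<close>
  also have "?this \<longleftrightarrow> ((\<lambda>\<beta>. M_mat q \<beta> (cos z) m n) \<longlongrightarrow>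
     (\<Sum>k\<le>?N. ((\<Prod>j<k. 0 - of_real q ^ j) * (\<Prod>j<?N - k. 0 - of_real q ^ j))
        * inverse (qpoch (of_real q) q k * qpoch (of_real q) q (?N - k))
      * (exp (\<i> * z) ^ (?N - k) * inverse (exp (\<i> * z)) ^ k)) / 1) (at 0 within S)"
    by (rule filterlim_cong) (use assms in \<open>auto simp: M_mat_eq eventually_at_filter\<close>)
  finally show ?thesis
    by (simp add: q_inv_Hermite_fps_nth divide_inverse)
qed

section \<open>Toeplitz matrices and the theorem\<close>

definition lower_toeplitz :: "complex fps \<Rightarrow> int \<Rightarrow> int \<Rightarrow> complex" where
  "lower_toeplitz f m n = (if n \<le> m then fps_nth f (nat (m - n)) else 0)"

lemma lt_mult_lower_toeplitz:
  "lt_mult (lower_toeplitz f) (lower_toeplitz g) = lower_toeplitz (f * g)"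
proof (intro ext)
  fix m n :: int
  have "(\<Sum>k = n..m. lower_toeplitz f m k * lower_toeplitz g k n)
      = (\<Sum>i = 0..nat (m - n). fps_nth f i * fps_nth g (nat (m - n) - i))" if "n \<le> m"
    by (rule sum.reindex_bij_witness[of _ "\<lambda>i. m - int i" "\<lambda>k. nat (m - k)"])
      (use that in \<open>auto simp: lower_toeplitz_def nat_diff_distrib' intro!: arg_cong2[of _ _ _ _ "(*)"] arg_cong[of _ _ "fps_nth _"]\<close>)
  then show "lt_mult (lower_toeplitz f) (lower_toeplitz g) m n = lower_toeplitz (f * g) m n"
    by (simp add: lt_mult_def lower_toeplitz_def fps_mult_nth)
qed

lemma lower_toeplitz_1: "lower_toeplitz 1 = id_mat"
  by (auto simp: fun_eq_iff lower_toeplitz_def id_mat_def)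

theorem theorem5p1:
  fixes q :: real and x :: complex
  assumes "0 < q" and "q < 1"
  shows "(\<forall>m n. ((\<lambda>\<beta>. L_mat q \<beta> x m n) \<longlongrightarrow> L0_mat q x m n) (at 0 within admissible q))
    \<and> (\<forall>m n. ((\<lambda>\<beta>. M_mat q \<beta> x m n) \<longlongrightarrow> M0_mat q x m n) (at 0 within admissible q))
    \<and> lower_triangular (L0_mat q x)
    \<and> lower_triangular (M0_mat q x)
    \<and> (\<forall>m n. n \<le> m \<longrightarrow>
         L0_mat q x m n = poly (q_Hermite (nat (m - n)) q) x / qpoch (of_real q) q (nat (m - n)))
    \<and> (\<forall>m n. n \<le> m \<longrightarrow>
         M0_mat q x m n = (- 1) ^ nat (m - n) * of_real (q ^ (nat (m - n) choose 2))
           * poly (q_Hermite (nat (m - n)) (1 / q)) x / qpoch (of_real q) q (nat (m - n)))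
    \<and> lt_mult (L0_mat q x) (M0_mat q x) = id_mat
    \<and> lt_mult (M0_mat q x) (L0_mat q x) = id_mat"
proof -
  obtain z where x: "x = cos z"
    by (metis cos_Arccos)
  define f g where "f = q_Hermite_fps q (exp (\<i> * z))" and "g = q_inv_Hermite_fps q (exp (\<i> * z))"
  have L: "((\<lambda>\<beta>. L_mat q \<beta> x m n) \<longlongrightarrow> lower_toeplitz f m n) (at 0 within admissible q)" for m n
    using L_mat_tendsto[of n m q z] by (cases "n \<le> m") (simp_all add: lower_toeplitz_def x f_def L_mat_def)
  have M: "((\<lambda>\<beta>. M_mat q \<beta> x m n) \<longlongrightarrow> lower_toeplitz g m n) (at 0 within admissible q)" for m n
    using M_mat_tendsto[of q n m z] assms
    by (cases "n \<le> m") (simp_all add: lower_toeplitz_def x g_def M_mat_def)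
  have L0: "L0_mat q x = lower_toeplitz f" and M0: "M0_mat q x = lower_toeplitz g"
    using tendsto_Lim[OF at_0_within_admissible_neq_bot[OF assms(1)] L]
      tendsto_Lim[OF at_0_within_admissible_neq_bot[OF assms(1)] M]
    by (auto simp: fun_eq_iff L0_mat_def M0_mat_def)
  have fg: "f * g = 1"
    unfolding f_def g_def by (rule q_Hermite_fps_mult[OF assms])
  then have gf: "g * f = 1"
    by (simp only: mult.commute)
  have "L0_mat q x m n = poly (q_Hermite (nat (m - n)) q) x / qpoch (of_real q) q (nat (m - n))"
    if "n \<le> m" for m n
    using that unfolding L0 by (simp add: lower_toeplitz_def f_def x q_Hermite_fps_nth_eq_poly[OF assms])
  moreover have "M0_mat q x m n = (- 1) ^ nat (m - n) * of_real (q ^ (nat (m - n) choose 2))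
           * poly (q_Hermite (nat (m - n)) (1 / q)) x / qpoch (of_real q) q (nat (m - n))"
    if "n \<le> m" for m n
    using that unfolding M0 by (simp add: lower_toeplitz_def g_def x q_inv_Hermite_fps_nth_eq_poly[OF assms])
  moreover have "lower_triangular (L0_mat q x)" "lower_triangular (M0_mat q x)"
    by (auto simp: L0 M0 lower_triangular_def lower_toeplitz_def)
  moreover have "lt_mult (L0_mat q x) (M0_mat q x) = id_mat" "lt_mult (M0_mat q x) (L0_mat q x) = id_mat"
    by (simp_all add: L0 M0 lt_mult_lower_toeplitz fg gf lower_toeplitz_1)
  ultimately show ?thesis
    using L M unfolding L0[symmetric] M0[symmetric] by blast
qed

end
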